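(* Let $\mathcal{A}$ be a Boolean tensor of size $I_1\times\cdots\times I_M\times J_1\times\cdots\times J_N$. Then the following statements are equivalent: (a) A $\{1,4\}$-inverse $\mathcal{A}^{(1,4)}$ of $\mathcal{A}$ exists. (b) A generalized inverse $\mathcal{A}^{(1)}$ of $\mathcal{A}$ exists and $\mathfrak{R}(\mathcal{A})=\mathfrak{R}(\mathcal{A}*_N\mathcal{A}^T)$. (c) A generalized inverse $(\mathcal{A}*_N\mathcal{A}^T)^{(1)}$ of $\mathcal{A}*_N\mathcal{A}^T$ exists and $\mathcal{X}*_M\mathcal{A}*_N\mathcal{A}^T=\mathcal{A}^T$ for some Boolean tensor $\mathcal{X}$ of size $J_1\times\cdots\times J_N\times I_1\times\cdots\times I_M$.
   Context: A Boolean tensor is an array with entries in $\{0,1\}$; entries are added and multiplied by the rules of the binary Boolean algebra ($1+1=1$, otherwise as usual). For $\mathcal{A}$ of size $I_1\times\cdots\times I_M\times J_1\times\cdots\times J_N$ and $\mathcal{B}$ of size $J_1\times\cdots\times J_N\times K_1\times\cdots\times K_L$, the Einstein product $\mathcal{A}*_N\mathcal{B}$ has entries $\sum_{j_1,\dots,j_N}a_{i_1\ldots i_Mj_1\ldots j_N}b_{j_1\ldots j_Nk_1\ldots k_L}$ (Boolean sum; the $k$-indices may be absent); the subscript of $*$ is the number of contracted indices. The transpose is $(\mathcal{A}^T)_{j_1\ldots j_Ni_1\ldots i_M}=a_{i_1\ldots i_Mj_1\ldots j_N}$. The range is $\mathfrak{R}(\mathcal{A})=\{\mathcal{A}*_N\mathcal{X}:\mathcal{X}\text{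 a Boolean tensor of size }J_1\times\cdots\times J_N\}$. A generalized inverse $\mathcal{A}^{(1)}$ of $\mathcal{A}$ is a Boolean tensor $\mathcal{X}$ of size $J_1\times\cdots\times J_N\times I_1\times\cdots\times I_M$ with $\mathcal{A}*_N\mathcal{X}*_M\mathcal{A}=\mathcal{A}$ (analogously for any other tensor); a $\{1,4\}$-inverse $\mathcal{A}^{(1,4)}$ is a generalized inverse which in addition satisfies $(\mathcal{X}*_M\mathcal{A})^T=\mathcal{X}*_M\mathcal{A}$. *)

theory Defs
  imports Main "HOL-Library.FuncSet"
begin

text \<open>
  Entries are of type \<^typ>\<open>bool\<close>: 0 is \<^const>\<open>False\<close>, 1 is \<^const>\<open>True\<close>, addition is disjunction
  and multiplication is conjunction. A size \<open>I\<^sub>1 \<times> \<dots> \<times> I\<^sub>M\<close> is the list of its dimensions, so the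
  size \<open>I\<^sub>1 \<times> \<dots> \<times> I\<^sub>M \<times> J\<^sub>1 \<times> \<dots> \<times> J\<^sub>N\<close> is \<open>Is @ Js\<close>; multi-indices are concatenated likewise.
\<close>

type_synonym btensor = "nat list \<Rightarrow> bool"

definition indices :: "nat list \<Rightarrow> nat list set" where
  "indices ds = {is. list_all2 (\<lambda>i d. i \<in> {1..d}) is ds}"

text \<open>Extensionality off the index set makes HOL equality the entrywise equality of tensors.\<close>

definition btensors :: "nat list \<Rightarrow> btensor set" where
  "btensors ds = indices ds \<rightarrow>\<^sub>E UNIV"

text \<open>The finite sum for the addition with \<open>1 + 1 = 1\<close>.\<close>

definition bool_sum :: "('a \<Rightarrow> bool) \<Rightarrow> 'a set \<Rightarrow> bool" where
  "bool_sum = comm_monoid_set.F (\<or>) False"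

text \<open>
  \<open>einstein Is Js Ks A B\<close> is \<open>A *\<^sub>N B\<close> for \<open>A\<close> of size \<open>Is @ Js\<close> and \<open>B\<close> of size \<open>Js @ Ks\<close>, where
  \<open>N = length Js\<close>. The case \<open>Ks = []\<close> is the one of absent \<open>k\<close>-indices.
\<close>

definition einstein ::
  "nat list \<Rightarrow> nat list \<Rightarrow> nat list \<Rightarrow> btensor \<Rightarrow> btensor \<Rightarrow> btensor" where
  "einstein Is Js Ks A B =
     (\<lambda>l\<in>indices (Is @ Ks).
        let i = take (length Is) l; k = drop (length Is) l
        in bool_sum (\<lambda>j. A (i @ j) \<and> B (j @ k)) (indices Js))"

text \<open>\<open>transpose_tensor Is Js A\<close> has size \<open>Js @ Is\<close>, for \<open>A\<close> of size \<open>Is @ Js\<close>.\<close>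

definition transpose_tensor :: "nat list \<Rightarrow> nat list \<Rightarrow> btensor \<Rightarrow> btensor" where
  "transpose_tensor Is Js A =
     (\<lambda>l\<in>indices (Js @ Is).
        let j = take (length Js) l; i = drop (length Js) l in A (i @ j))"

definition tensor_range :: "nat list \<Rightarrow> nat list \<Rightarrow> btensor \<Rightarrow> btensor set" where
  "tensor_range Is Js A = {einstein Is Js [] A X | X. X \<in> btensors Js}"

definition is_g_inverse :: "nat list \<Rightarrow> nat list \<Rightarrow> btensor \<Rightarrow> btensor \<Rightarrow> bool" where
  "is_g_inverse Is Js A X \<longleftrightarrow>
     X \<in> btensors (Js @ Is) \<and> einstein Is Is Js (einstein Is Js Is A X) A = A"

definition is_14_inverse :: "nat list \<Rightarrow> nat list \<Rightarrow> btensor \<Rightarrow> btensor \<Rightarrow> bool" where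
  "is_14_inverse Is Js A X \<longleftrightarrow>
     is_g_inverse Is Js A X \<and>
     transpose_tensor Js Js (einstein Js Is Js X A) = einstein Js Is Js X A"

lemma finite_indices: "finite (indices ds)"
proof -
  have "indices ds \<subseteq> {is. set is \<subseteq> {1..Max (set ds)} \<and> length is = length ds}"
    by (fastforce simp: indices_def list_all2_conv_all_nth in_set_conv_nth
        intro: order_trans Max_ge)
  then show ?thesis
    by (rule finite_subset) (rule finite_lists_length_eq, simp)
qed

lemma bool_sum_iff:
  assumes "finite S"
  shows "bool_sum f S \<longleftrightarrow> (\<exists>x\<in>S. f x)"
proof -
  interpret b: comm_monoid_set "(\<or>)" False
    by unfold_locales auto
  show ?thesis
    unfolding bool_sum_def using assms by (induction S) auto
qed

lemma einstein_entry:
  assumes "i \<in> indices Is" "k \<in> indices Ks"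
  shows "einstein Is Js Ks A B (i @ k) \<longleftrightarrow> (\<exists>j\<in>indices Js. A (i @ j) \<and> B (j @ k))"
proof -
  have "length i = length Is" "i @ k \<in> indices (Is @ Ks)"
    using assms by (auto simp: indices_def list_all2_appendI dest: list_all2_lengthD)
  then show ?thesis
    by (simp add: einstein_def bool_sum_iff finite_indices)
qed

lemma transpose_tensor_entry:
  assumes "i \<in> indices Is" "j \<in> indices Js"
  shows "transpose_tensor Is Js A (j @ i) = A (i @ j)"
proof -
  have "length j = length Js" "j @ i \<in> indices (Js @ Is)"
    using assms by (auto simp: indices_def list_all2_appendI dest: list_all2_lengthD)
  then show ?thesis
    by (simp add: transpose_tensor_def)
qed

end

theory Submission
  imports Defs
begin

text \<open>
  Read tensors as Boolean matrices, with the multi-indices over \<open>Is\<close> and \<open>Js\<close> as row and column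
  indices. The three statements are then all equivalent to the solvability of the single equation
  \<open>X A A\<^sup>T = A\<^sup>T\<close>. Apart from one argument with columns, about ranges, this is algebra with
  associativity, \<open>(A B)\<^sup>T = B\<^sup>T A\<^sup>T\<close> and \<open>A\<^sup>T\<^sup>T = A\<close>.

  For (a) the very same \<open>X\<close> serves on both sides. If \<open>A X A = A\<close> and \<open>X A\<close> is symmetric, then
  transposing the first equation gives \<open>A\<^sup>T = (X A)\<^sup>T A\<^sup>T = X A A\<^sup>T\<close>. Conversely, let
  \<open>X A A\<^sup>T = A\<^sup>T\<close>. Then \<open>A = A A\<^sup>T X\<^sup>T\<close>, so \<open>X A = X (A A\<^sup>T) X\<^sup>T\<close> is symmetric, and
  \<open>A (X A) = A (X A)\<^sup>T = A A\<^sup>T X\<^sup>T = A\<close> (lemma \<open>is_14_inverse_iff\<close>).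

  For (b), an inclusion of ranges \<open>\<RR>(A) \<subseteq> \<RR>(B)\<close> is a factorization \<open>A = B U\<close>
  (lemma \<open>tensor_range_subset_iff\<close>). Since \<open>\<RR>(A A\<^sup>T) \<subseteq> \<RR>(A)\<close> always holds, equality of the
  ranges says that \<open>A = A A\<^sup>T U\<close> for some \<open>U\<close>, which is the transposed equation with \<open>X = U\<^sup>T\<close>.

  For (c), if \<open>X A A\<^sup>T = A\<^sup>T\<close> and \<open>B = A A\<^sup>T\<close>, then \<open>B X\<^sup>T X B = (B X\<^sup>T) (X B) = A A\<^sup>T = B\<close>,
  so that \<open>X\<^sup>T X\<close> is a generalized inverse of \<open>B\<close> (lemma \<open>is_g_inverse_gram\<close>).
\<close>

section \<open>Entrywise equality\<close>

lemma indices_append_iff: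
  "l \<in> indices (Is @ Js) \<longleftrightarrow> (\<exists>i\<in>indices Is. \<exists>j\<in>indices Js. l = i @ j)"
  unfolding indices_def
  by (auto simp: list_all2_append2 intro: list_all2_appendI dest: list_all2_lengthD)

lemma Nil_in_indices: "[] \<in> indices []"
  by (simp add: indices_def)

lemma length_indices: "i \<in> indices Is \<Longrightarrow> length i = length Is"
  by (auto simp: indices_def dest: list_all2_lengthD)

lemma btensors_eqI:
  assumes "A \<in> btensors (Is @ Js)" "B \<in> btensors (Is @ Js)"
    and "\<And>i j. i \<in> indices Is \<Longrightarrow> j \<in> indices Js \<Longrightarrow> A (i @ j) = B (i @ j)"
  shows "A = B"
  using assms(1,2) unfolding btensors_def
  by (rule PiE_ext) (auto simp: indices_append_iff assms(3))

lemma einstein_in_btensors: "einstein Is Js Ks A B \<in> btensors (Is @ Ks)"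
  by (simp add: einstein_def btensors_def)

lemma transpose_in_btensors: "transpose_tensor Is Js A \<in> btensors (Js @ Is)"
  by (simp add: transpose_tensor_def btensors_def)

section \<open>Algebra of the Einstein product and the transpose\<close>

lemma einstein_assoc:
  "einstein Is Ks Ls (einstein Is Js Ks A B) C = einstein Is Js Ls A (einstein Js Ks Ls B C)"
  by (rule btensors_eqI[OF einstein_in_btensors einstein_in_btensors])
    (auto simp: einstein_entry)

lemma transpose_einstein:
  "transpose_tensor Is Ks (einstein Is Js Ks A B) =
     einstein Ks Js Is (transpose_tensor Js Ks B) (transpose_tensor Is Js A)"
  by (rule btensors_eqI[OF transpose_in_btensors einstein_in_btensors])
    (auto simp: einstein_entry transpose_tensor_entry)

lemma transpose_transpose:
  assumes "A \<in> btensors (Is @ Js)"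
  shows "transpose_tensor Js Is (transpose_tensor Is Js A) = A"
  by (rule btensors_eqI[OF transpose_in_btensors assms]) (simp add: transpose_tensor_entry)

section \<open>Ranges and factorizations\<close>

text \<open>
  The range of \<open>A\<close> consists of the sums of columns of \<open>A\<close>, so it lies in the range of \<open>B\<close> exactly
  when every column of \<open>A\<close> does, that is, has the form \<open>B x\<close>. The vectors \<open>x\<close> chosen for the
  different columns are the columns of \<open>U\<close>.
\<close>

lemma tensor_range_subset_iff:
  assumes A: "A \<in> btensors (Is @ Js)"
  shows "tensor_range Is Js A \<subseteq> tensor_range Is Ks B \<longleftrightarrow>
    (\<exists>U\<in>btensors (Ks @ Js). A = einstein Is Ks Js B U)"
proof
  assume sub: "tensor_range Is Js A \<subseteq> tensor_range Is Ks B"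
  have "\<exists>x. \<forall>i\<in>indices Is. A (i @ j) = (\<exists>k\<in>indices Ks. B (i @ k) \<and> x k)"
    if j: "j \<in> indices Js" for j
  proof -
    \<comment> \<open>The unit vector \<open>e\<close> picks out the column of \<open>A\<close> with index \<open>j\<close>.\<close>
    define e where "e = (\<lambda>l\<in>indices Js. l = j)"
    have "e \<in> btensors Js" by (simp add: e_def btensors_def)
    then have "einstein Is Js [] A e \<in> tensor_range Is Ks B"
      using sub by (auto simp: tensor_range_def)
    then obtain x where x: "einstein Is Js [] A e = einstein Is Ks [] B x"
      by (auto simp: tensor_range_def)
    have "A (i @ j) = (\<exists>k\<in>indices Ks. B (i @ k) \<and> x k)" if i: "i \<in> indices Is" for i
      using fun_cong[OF x, of "i @ []"] j
      unfolding einstein_entry[OF i Nil_in_indices] by (auto simp: e_def)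
    then show ?thesis by blast
  qed
  then obtain x where x:
    "\<And>i j. \<lbrakk>i \<in> indices Is; j \<in> indices Js\<rbrakk> \<Longrightarrow>
       A (i @ j) = (\<exists>k\<in>indices Ks. B (i @ k) \<and> x j k)"
    by metis
  define U where
    "U = (\<lambda>l\<in>indices (Ks @ Js). x (drop (length Ks) l) (take (length Ks) l))"
  have U: "U \<in> btensors (Ks @ Js)" by (simp add: U_def btensors_def)
  have U_entry: "U (k @ j) = x j k" if "k \<in> indices Ks" "j \<in> indices Js" for k j
    using that by (auto simp: U_def indices_append_iff length_indices)
  have "A = einstein Is Ks Js B U"
    by (rule btensors_eqI[OF A einstein_in_btensors]) (simp add: einstein_entry x U_entry)
  with U show "\<exists>U\<in>btensors (Ks @ Js). A = einstein Is Ks Js B U" by blast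
next
  assume "\<exists>U\<in>btensors (Ks @ Js). A = einstein Is Ks Js B U"
  then obtain U where A_eq: "A = einstein Is Ks Js B U" by blast
  have "einstein Ks Js [] U x \<in> btensors Ks" for x
    using einstein_in_btensors[of Ks Js "[]"] by simp
  then show "tensor_range Is Js A \<subseteq> tensor_range Is Ks B"
    unfolding A_eq tensor_range_def einstein_assoc by blast
qed

section \<open>The equation \<open>X A A\<^sup>T = A\<^sup>T\<close>\<close>

text \<open>
  Transposition turns one equation into the other, because \<open>A A\<^sup>T\<close> is symmetric. The transposed
  form exhibits the columns of \<open>A\<close> as elements of the range of \<open>A A\<^sup>T\<close>.
\<close>

lemma transpose_equation_iff:
  assumes A: "A \<in> btensors (Is @ Js)" and X: "X \<in> btensors (Js @ Is)"
  shows "einstein Js Js Is (einstein Js Is Js X A) (transpose_tensor Is Js A) =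
      transpose_tensor Is Js A \<longleftrightarrow>
    A = einstein Is Is Js (einstein Is Js Is A (transpose_tensor Is Js A))
      (transpose_tensor Js Is X)"
    (is "?L = ?At \<longleftrightarrow> A = ?R")
proof -
  have "transpose_tensor Js Is ?L = ?R"
    by (simp add: einstein_assoc transpose_einstein transpose_transpose[OF A])
  moreover have "transpose_tensor Is Js ?R = ?L"
    by (simp add: einstein_assoc transpose_einstein transpose_transpose[OF A]
        transpose_transpose[OF X])
  ultimately show ?thesis
    using transpose_transpose[OF A] by metis
qed

text \<open>
  A \<open>{1,4}\<close>-inverse is nothing but a solution of the equation: a solution satisfies
  \<open>X A = X (A A\<^sup>T) X\<^sup>T\<close>, so the equation carries the symmetry of \<open>X A\<close> with it, and this
  symmetry turns \<open>A X A\<close> into \<open>A A\<^sup>T X\<^sup>T = A\<close>.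
\<close>

lemma is_14_inverse_iff:
  assumes A: "A \<in> btensors (Is @ Js)"
  shows "is_14_inverse Is Js A X \<longleftrightarrow>
    X \<in> btensors (Js @ Is) \<and>
    einstein Js Js Is (einstein Js Is Js X A) (transpose_tensor Is Js A) =
      transpose_tensor Is Js A"
    (is "?inv \<longleftrightarrow> ?solves")
proof
  let ?At = "transpose_tensor Is Js A"
  let ?XA = "einstein Js Is Js X A"
  assume ?inv
  then have X: "X \<in> btensors (Js @ Is)" and AXA: "einstein Is Js Js A ?XA = A"
    and sym: "transpose_tensor Js Js ?XA = ?XA"
    by (auto simp: is_14_inverse_def is_g_inverse_def einstein_assoc)
  have "?At = transpose_tensor Is Js (einstein Is Js Js A ?XA)" by (simp add: AXA)
  also have "\<dots> = einstein Js Js Is ?XA ?At" by (subst transpose_einstein) (simp only: sym)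
  finally show ?solves using X by simp
next
  let ?At = "transpose_tensor Is Js A"
  let ?Xt = "transpose_tensor Js Is X"
  let ?XA = "einstein Js Is Js X A"
  let ?AAt = "einstein Is Js Is A ?At"
  assume ?solves
  then have X: "X \<in> btensors (Js @ Is)" and A_eq: "einstein Is Is Js ?AAt ?Xt = A"
    using transpose_equation_iff[OF A] by auto
  have "transpose_tensor Js Js (einstein Js Is Js X (einstein Is Is Js ?AAt ?Xt)) =
      einstein Js Is Js X (einstein Is Is Js ?AAt ?Xt)"
    by (simp only: einstein_assoc transpose_einstein transpose_transpose[OF A]
        transpose_transpose[OF X])
  then have sym: "transpose_tensor Js Js ?XA = ?XA" by (simp only: A_eq)
  have "einstein Is Js Js A ?XA = einstein Is Js Js A (transpose_tensor Js Js ?XA)"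
    by (simp only: sym)
  also have "\<dots> = einstein Is Is Js ?AAt ?Xt"
    by (simp only: transpose_einstein einstein_assoc)
  finally have "einstein Is Js Js A ?XA = A" by (simp only: A_eq)
  then show ?inv
    using X sym by (simp add: is_14_inverse_def is_g_inverse_def einstein_assoc)
qed

text \<open>
  With \<open>B = A A\<^sup>T\<close>, the equation and its transpose read \<open>X B = A\<^sup>T\<close> and \<open>B X\<^sup>T = A\<close>, so
  sandwiching \<open>X\<^sup>T X\<close> between two copies of \<open>B\<close> gives \<open>A A\<^sup>T\<close> again.
\<close>

lemma is_g_inverse_gram:
  assumes A: "A \<in> btensors (Is @ Js)" and X: "X \<in> btensors (Js @ Is)"
    and eq: "einstein Js Js Is (einstein Js Is Js X A) (transpose_tensor Is Js A) =
      transpose_tensor Is Js A"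
  shows "is_g_inverse Is Is (einstein Is Js Is A (transpose_tensor Is Js A))
    (einstein Is Js Is (transpose_tensor Js Is X) X)"
proof -
  let ?At = "transpose_tensor Is Js A"
  let ?Xt = "transpose_tensor Js Is X"
  let ?B = "einstein Is Js Is A ?At"
  have BXt: "einstein Is Is Js ?B ?Xt = A"
    using transpose_equation_iff[OF A X] eq by simp
  have "einstein Is Is Is (einstein Is Is Is ?B (einstein Is Js Is ?Xt X)) ?B =
      einstein Is Js Is (einstein Is Is Js ?B ?Xt) (einstein Js Is Is X ?B)"
    by (simp only: einstein_assoc)
  also have "einstein Js Is Is X ?B = ?At" using eq by (simp only: einstein_assoc)
  finally have "einstein Is Is Is (einstein Is Is Is ?B (einstein Is Js Is ?Xt X)) ?B = ?B"
    by (simp only: BXt)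
  then show ?thesis by (simp add: is_g_inverse_def einstein_in_btensors)
qed

lemma tensor_range_gram_eq_iff:
  assumes A: "A \<in> btensors (Is @ Js)"
  shows "tensor_range Is Js A =
      tensor_range Is Is (einstein Is Js Is A (transpose_tensor Is Js A)) \<longleftrightarrow>
    (\<exists>X\<in>btensors (Js @ Is).
       einstein Js Js Is (einstein Js Is Js X A) (transpose_tensor Is Js A) =
         transpose_tensor Is Js A)"
    (is "_ = tensor_range Is Is ?B \<longleftrightarrow> ?solvable")
proof -
  have "tensor_range Is Is ?B \<subseteq> tensor_range Is Js A"
    using tensor_range_subset_iff[OF einstein_in_btensors] transpose_in_btensors by blast
  then have "tensor_range Is Js A = tensor_range Is Is ?B \<longleftrightarrow>
      (\<exists>U\<in>btensors (Is @ Js). A = einstein Is Is Js ?B U)"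
    using tensor_range_subset_iff[OF A] by blast
  also have "\<dots> \<longleftrightarrow>
      (\<exists>X\<in>btensors (Js @ Is). A = einstein Is Is Js ?B (transpose_tensor Js Is X))"
    by (metis transpose_transpose transpose_in_btensors)
  also have "\<dots> \<longleftrightarrow> ?solvable"
    using transpose_equation_iff[OF A] by blast
  finally show ?thesis .
qed

theorem theorem3p23:
  fixes Is Js :: "nat list" and A :: btensor
  assumes "A \<in> btensors (Is @ Js)"
  shows
    "((\<exists>X. is_14_inverse Is Js A X) \<longleftrightarrow>
      (\<exists>X. is_g_inverse Is Js A X) \<and>
      tensor_range Is Js A =
        tensor_range Is Is (einstein Is Js Is A (transpose_tensor Is Js A))) \<and>
     ((\<exists>X. is_g_inverse Is Js A X) \<and>
      tensor_range Is Js A =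
        tensor_range Is Is (einstein Is Js Is A (transpose_tensor Is Js A)) \<longleftrightarrow>
      (\<exists>Y. is_g_inverse Is Is (einstein Is Js Is A (transpose_tensor Is Js A)) Y) \<and>
      (\<exists>X\<in>btensors (Js @ Is).
         einstein Js Js Is (einstein Js Is Js X A) (transpose_tensor Is Js A) =
           transpose_tensor Is Js A))"
proof -
  let ?B = "einstein Is Js Is A (transpose_tensor Is Js A)"
  let ?solvable = "\<exists>X\<in>btensors (Js @ Is).
    einstein Js Js Is (einstein Js Is Js X A) (transpose_tensor Is Js A) =
      transpose_tensor Is Js A"
  have a: "(\<exists>X. is_14_inverse Is Js A X) \<longleftrightarrow> ?solvable"
    using is_14_inverse_iff[OF assms] by blast
  have "?solvable \<Longrightarrow> \<exists>X. is_g_inverse Is Js A X"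
    using a by (auto simp: is_14_inverse_def)
  moreover have "?solvable \<Longrightarrow> \<exists>Y. is_g_inverse Is Is ?B Y"
    using is_g_inverse_gram[OF assms] by blast
  ultimately show ?thesis
    unfolding a tensor_range_gram_eq_iff[OF assms] by blast
qed

end
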